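(* Let $q=2^m$, where $m$ is a positive integer, and let $a,b\in\mathbb{F}_q^*$. Then the polynomial $$f_1(X)=X^{2q^2}+aX^{q^2+q-1}+bX^{q^2-q+1}$$ is a permutation polynomial over $\mathbb{F}_{q^3}$ if and only if $b=a$.
   Context: A polynomial $f\in\mathbb{F}_{Q}[X]$ is a permutation polynomial over $\mathbb{F}_Q$ if the map $c\mapsto f(c)$ is a bijection of $\mathbb{F}_Q$. $\mathbb{F}_q^*$ denotes the set of nonzero elements of $\mathbb{F}_q$, and $\mathbb{F}_q\subseteq\mathbb{F}_{q^3}$. *)

theory Defs
  imports Complex_Main "HOL-Library.Cardinality" "HOL-Computational_Algebra.Polynomial"
begin

definition is_subfield :: "'a::field set \<Rightarrow> bool" where
  "is_subfield K \<longleftrightarrow>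
     0 \<in> K \<and> 1 \<in> K \<and>
     (\<forall>x\<in>K. \<forall>y\<in>K. x + y \<in> K) \<and> (\<forall>x\<in>K. - x \<in> K) \<and>
     (\<forall>x\<in>K. \<forall>y\<in>K. x * y \<in> K) \<and> (\<forall>x\<in>K. x \<noteq> 0 \<longrightarrow> inverse x \<in> K)"

text \<open>The finite field over which the polynomial is considered is the whole type.\<close>

definition permutation_poly :: "'a::{field,finite} poly \<Rightarrow> bool" where
  "permutation_poly f \<longleftrightarrow> bij (\<lambda>c. poly f c)"

text \<open>For \<open>q \<ge> 1\<close> the truncated subtractions on naturals in the exponents are exact.\<close>

definition f1 :: "nat \<Rightarrow> 'a::comm_semiring_1 \<Rightarrow> 'a \<Rightarrow> 'a poly" where
  "f1 q a b = monom 1 (2 * q^2) + monom a (q^2 + q - 1) + monom b (q^2 - q + 1)"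

end

theory Submission
  imports Defs "HOL-Number_Theory.Residues"
begin

text \<open>
  Write \<open>p, r, s\<close> for \<open>p, p^q, p^(q\<^sup>2)\<close>. The map \<open>p \<mapsto> p^(q+1)\<close> permutes the field: if
  \<open>T = p r\<close>, then \<open>T^q = r s\<close> and \<open>T^(q\<^sup>2) = s p\<close>, so \<open>p\<^sup>2 T^q = T T^(q\<^sup>2)\<close> recovers \<open>p\<close> from \<open>T\<close> in
  characteristic 2. Hence \<open>x = r s\<close> is a bijective substitution, and with \<open>\<alpha>\<^sup>2 = a\<close>, \<open>\<beta>\<^sup>2 = b\<close> it gives
  \<open>f\<^sub>1(x) = p\<^sup>2 r\<^sup>2 + a p\<^sup>2 + b r\<^sup>2 = ((p + \<beta>) (r + \<alpha>) + \<alpha> \<beta>)\<^sup>2\<close>.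
  So \<open>f\<^sub>1\<close> is a permutation iff \<open>p \<mapsto> (p + \<beta>) (p^q + \<alpha>)\<close> is one. That map vanishes at both \<open>\<alpha>\<close>
  and \<open>\<beta>\<close>, which forces \<open>\<alpha> = \<beta>\<close>; and if \<open>\<alpha> = \<beta>\<close> it is \<open>p \<mapsto> (p + \<alpha>)^(q+1)\<close>.
\<close>

text \<open>Fermat's argument: multiplication by a nonzero \<open>x\<close> permutes
  \<open>K - {0}\<close>, so comparing the products over that set gives
  \<open>x ^ (card K - 1) = 1\<close>. With \<open>K = UNIV\<close> this yields
  \<open>x ^ q ^ 3 = x\<close>.\<close>

lemma subfield_power_card:
  fixes K :: "'a::field set"
  assumes K: "is_subfield K" and fin: "finite K" and x: "x \<in> K"
  shows "x ^ card K = x"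
proof (cases "x = 0")
  case True
  have "card K > 0" using fin x by (auto simp: card_gt_0_iff)
  with True show ?thesis by simp
next
  case False
  let ?G = "K - {0}"
  have "bij_betw ((*) x) ?G ?G"
  proof (rule bij_betw_byWitness[where f' = "(*) (inverse x)"])
    show "(*) x ` ?G \<subseteq> ?G" "(*) (inverse x) ` ?G \<subseteq> ?G"
      using K x False unfolding is_subfield_def by auto
  qed (use False in auto)
  then have "(\<Prod>y\<in>?G. y) = (\<Prod>y\<in>?G. x * y)"
    by (rule prod.reindex_bij_betw[symmetric])
  also have "\<dots> = x ^ card ?G * (\<Prod>y\<in>?G. y)"
    by (simp add: prod.distrib)
  finally have "x ^ card ?G = 1"
    using fin by simp
  moreover have "card K = Suc (card ?G)"
    using fin K by (intro card.remove) (auto simp: is_subfield_def)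
  ultimately show ?thesis by simp
qed

lemma square_eq_iff_CHAR_2:
  fixes x y :: "'a::idom"
  assumes "CHAR('a) = 2"
  shows "x\<^sup>2 = y\<^sup>2 \<longleftrightarrow> x = y"
  by (simp only: power2_eq_iff uminus_CHAR_2[OF assms] disj_absorb)

lemma CHAR_eq_2_of_card:
  assumes "CARD('a::{field,finite}) = 2 ^ n"
  shows "CHAR('a) = 2"
proof -
  have "prime CHAR('a)"
    by (rule prime_CHAR_semidom) (rule finite_imp_CHAR_pos, simp)
  moreover have "CHAR('a) dvd 2 ^ n"
    using CHAR_dvd_CARD[where ?'a = 'a] assms by simp
  ultimately show ?thesis
    by (metis prime_dvd_power primes_dvd_imp_eq two_is_prime_nat)
qed

lemma inj_power_Suc_card_cubic:
  fixes q :: nat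
  assumes char: "CHAR('a::field) = 2"
    and cube: "\<And>x::'a. x ^ q ^ 3 = x"
  shows "inj (\<lambda>p::'a. p ^ Suc q)"
proof (rule injI)
  fix p p' :: 'a
  assume eq: "p ^ Suc q = p' ^ Suc q"
  have key: "t\<^sup>2 * (t ^ Suc q) ^ q = t ^ Suc q * (t ^ Suc q) ^ q\<^sup>2" for t :: 'a
  proof -
    have "(t ^ q\<^sup>2) ^ q = t"
      using cube[of t] by (simp add: power_mult[symmetric] power3_eq_cube power2_eq_square)
    then have "(t ^ q) ^ q\<^sup>2 = t"
      by (simp add: power_mult[symmetric] mult.commute)
    moreover have "(t ^ q) ^ q = t ^ q\<^sup>2"
      by (simp add: power_mult[symmetric] power2_eq_square)
    ultimately show ?thesis
      by (simp add: power_mult_distrib power2_eq_square mult_ac)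
  qed
  show "p = p'"
  \<comment> \<open>Recovering \<open>p\<^sup>2\<close> from \<open>key\<close> means cancelling
    \<open>(p ^ Suc q) ^ q\<close>, so zero is treated apart.\<close>
  proof (cases "p ^ Suc q = 0")
    case True
    with eq show ?thesis by (metis power_eq_0_iff)
  next
    case False
    then have "(p ^ Suc q) ^ q \<noteq> 0" by simp
    moreover have "p\<^sup>2 * (p ^ Suc q) ^ q = p'\<^sup>2 * (p ^ Suc q) ^ q"
      using key[of p] key[of p'] unfolding eq[symmetric] by metis
    ultimately have "p\<^sup>2 = p'\<^sup>2"
      by (metis mult_right_cancel)
    then show ?thesis
      by (simp add: square_eq_iff_CHAR_2[OF char])
  qed
qed

lemma poly_f1_substitution:
  fixes p a b :: "'a::field"
  assumes q: "q \<ge> 2" and cube: "p ^ q ^ 3 = p"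
  shows "poly (f1 q a b) ((p ^ Suc q) ^ q) = (p * p ^ q)\<^sup>2 + a * p\<^sup>2 + b * (p ^ q)\<^sup>2"
proof (cases "p = 0")
  case True
  \<comment> \<open>Since \<open>0 ^ 0 = 1\<close>, the exponents must be positive for both sides to
    vanish at 0.\<close>
  have "0 < q\<^sup>2 + q - 1" "0 < q" using q by (auto simp: power2_eq_square)
  with True show ?thesis by (simp add: f1_def poly_monom power_0_left)
next
  case False
  define r s x where "r = p ^ q" and "s = r ^ q" and "x = r * s"
  have sq: "s ^ q = p"
    using cube unfolding r_def s_def by (simp add: power_mult[symmetric] power3_eq_cube mult_ac)
  have x: "(p ^ Suc q) ^ q = x"
    by (simp add: x_def s_def r_def power_mult_distrib)
  have nz: "r \<noteq> 0" "s \<noteq> 0" "x \<noteq> 0"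
    using False by (auto simp: r_def s_def x_def)
  have xq: "x ^ q = s * p"
    by (simp add: x_def power_mult_distrib sq s_def[symmetric])
  have xqq: "x ^ q\<^sup>2 = p * r"
    unfolding power2_eq_square power_mult xq
    by (simp add: power_mult_distrib sq r_def[symmetric])
  \<comment> \<open>A factor \<open>x\<close> clears the subtraction: (s p)(p r) =
    \<open>p\<^sup>2\<close> (r s).\<close>
  have "x ^ (q\<^sup>2 + q - 1) * x = x ^ (q\<^sup>2 + q)"
    using q by (metis add_gr_0 less_le_trans power_minus_mult zero_less_numeral)
  also have "\<dots> = p\<^sup>2 * x"
    unfolding power_add xq xqq by (simp add: x_def power2_eq_square mult_ac)
  finally have e1: "x ^ (q\<^sup>2 + q - 1) = p\<^sup>2"
    using nz by (metis mult_right_cancel)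
  \<comment> \<open>Here a factor \<open>x ^ q\<close> clears it: (p r)(r s) =
    \<open>r\<^sup>2\<close> (s p).\<close>
  have "q \<le> q\<^sup>2" using q by (simp add: power2_eq_square)
  then have "x ^ (q\<^sup>2 - q + 1) * x ^ q = x ^ q\<^sup>2 * x"
    by (simp add: power_add[symmetric] power_Suc2[symmetric] del: power_Suc)
  also have "\<dots> = r\<^sup>2 * x ^ q"
    unfolding xq xqq by (simp add: x_def power2_eq_square mult_ac)
  finally have e2: "x ^ (q\<^sup>2 - q + 1) = r\<^sup>2"
    using nz by (metis mult_right_cancel power_eq_0_iff)
  have "x ^ (2 * q\<^sup>2) = (p * r)\<^sup>2"
    by (simp add: mult.commute[of 2] power_mult xqq)
  then show ?thesis
    by (simp only: x f1_def poly_add poly_monom e1 e2 r_def mult_1)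
qed

theorem theorem3p1:
  fixes m q :: nat
    and K :: "'a::{field,finite} set"
    and a b :: 'a
  assumes "m > 0"
    and "q = 2 ^ m"
    and "CARD('a) = q ^ 3"
    and "is_subfield K"
    and "card K = q"
    and "a \<in> K - {0}"
    and "b \<in> K - {0}"
  shows "permutation_poly (f1 q a b) \<longleftrightarrow> b = a"
proof -
  have q2: "q \<ge> 2"
    using assms(1,2) self_le_power[of 2 m] by simp
  have char: "CHAR('a) = 2"
    using assms(2,3) by (intro CHAR_eq_2_of_card[of "m * 3"]) (simp add: power_mult)
  then have two: "(2::'a) = 0"
    by (metis of_nat_CHAR of_nat_numeral)
  have frob: "(x + y) ^ 2 ^ n = x ^ 2 ^ n + y ^ 2 ^ n" for x y :: 'a and n
    by (rule freshmans_dream') (simp_all add: char)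
  have cube: "x ^ q ^ 3 = x" for x :: 'a
    using subfield_power_card[of UNIV x] assms(3) by (simp add: is_subfield_def)
  have fixK: "x ^ q = x" if "x \<in> K" for x
    using subfield_power_card[OF assms(4) _ that] assms(5) by simp
  \<comment> \<open>The root is \<open>x ^ (q div 2)\<close>, whose square is
    \<open>x ^ q = x\<close>. That it is fixed by the \<open>q\<close>-th power matters later: it
    gives \<open>\<psi> \<alpha> = 0\<close> and, for \<open>\<beta> = \<alpha>\<close>,
    \<open>p ^ q + \<alpha> = (p + \<alpha>) ^ q\<close>.\<close>
  have sqrt: "\<exists>y. y\<^sup>2 = x \<and> y ^ q = y" if "x \<in> K" for x
  proof (intro exI conjI)
    have "2 ^ (m - 1) * 2 = q"
      using assms(1,2) by (metis power_minus_mult)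
    then show "(x ^ 2 ^ (m - 1))\<^sup>2 = x"
      using fixK[OF that] by (simp add: power_mult[symmetric])
    show "(x ^ 2 ^ (m - 1)) ^ q = x ^ 2 ^ (m - 1)"
      using fixK[OF that] by (metis mult.commute power_mult)
  qed
  obtain \<alpha> \<beta> where \<alpha>: "\<alpha>\<^sup>2 = a" "\<alpha> ^ q = \<alpha>" and \<beta>: "\<beta>\<^sup>2 = b" "\<beta> ^ q = \<beta>"
    using sqrt assms(6,7) by blast
  define S where "S p = (p ^ Suc q) ^ q" for p :: 'a
  define \<psi> where "\<psi> p = (p + \<beta>) * (p ^ q + \<alpha>)" for p
  note inj_Suc = inj_power_Suc_card_cubic[OF char cube]
  have "(x ^ q) ^ q\<^sup>2 = x" for x :: 'a
    using cube[of x] by (simp add: power_mult[symmetric] power2_eq_square power3_eq_cube mult.assoc)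
  then have inj_q: "inj (\<lambda>p::'a. p ^ q)"
    by (rule inj_on_inverseI)
  have "inj S"
    using inj_compose[OF inj_q inj_Suc] by (simp add: S_def[abs_def] comp_def)
  then have "bij S"
    by (simp add: bij_def finite_UNIV_inj_surj)
  have f1_S: "poly (f1 q a b) (S p) = (\<psi> p + \<alpha> * \<beta>)\<^sup>2" for p
  proof -
    have "\<psi> p + \<alpha> * \<beta> = p * p ^ q + \<alpha> * p + \<beta> * p ^ q + 2 * (\<alpha> * \<beta>)"
      unfolding \<psi>_def by (simp add: algebra_simps)
    also have "\<dots> = p * p ^ q + \<alpha> * p + \<beta> * p ^ q"
      unfolding two by simp
    also have "\<dots>\<^sup>2 = (p * p ^ q)\<^sup>2 + (\<alpha> * p)\<^sup>2 + (\<beta> * p ^ q)\<^sup>2"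
      using frob[where n = 1] by simp
    finally show ?thesis
      using poly_f1_substitution[OF q2 cube, of a b p]
      by (simp add: S_def \<alpha>(1)[symmetric] \<beta>(1)[symmetric] power_mult_distrib)
  qed
  have "permutation_poly (f1 q a b) \<longleftrightarrow> inj (poly (f1 q a b))"
    unfolding permutation_poly_def bij_def
    using finite_UNIV_inj_surj[OF finite, of "poly (f1 q a b)"] by blast
  also have "\<dots> \<longleftrightarrow> inj (\<lambda>p. poly (f1 q a b) (S p))"
    using comp_inj_on_iff[OF \<open>inj S\<close>, of "poly (f1 q a b)"] \<open>bij S\<close>
    by (simp add: bij_is_surj comp_def)
  \<comment> \<open>Adding the constant \<open>\<alpha> * \<beta>\<close> and squaring are both
    injective in characteristic 2.\<close>
  also have "\<dots> \<longleftrightarrow> inj \<psi>"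
    by (simp add: f1_S inj_def square_eq_iff_CHAR_2[OF char])
  also have "\<dots> \<longleftrightarrow> \<beta> = \<alpha>"
  proof
    assume "inj \<psi>"
    have "x + x = 0" for x :: 'a
      using minus_CHAR_2[OF char, of x x] by simp
    then have "\<psi> \<beta> = \<psi> \<alpha>"
      unfolding \<psi>_def \<alpha>(2) by (simp only: mult_zero_left mult_zero_right)
    with \<open>inj \<psi>\<close> show "\<beta> = \<alpha>"
      by (rule injD)
  next
    assume "\<beta> = \<alpha>"
    then have \<psi>: "\<psi> p = (p + \<alpha>) ^ Suc q" for p
      using frob[of p \<alpha> m] \<alpha>(2) by (simp add: \<psi>_def assms(2))
    have "p + \<alpha> = p' + \<alpha>" if "\<psi> p = \<psi> p'" for p p'
      using that unfolding \<psi> by (rule injD[OF inj_Suc])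
    then show "inj \<psi>"
      by (simp add: inj_def)
  qed
  also have "\<dots> \<longleftrightarrow> b = a"
    using square_eq_iff_CHAR_2[OF char, of \<beta> \<alpha>] by (simp add: \<alpha>(1) \<beta>(1))
  finally show ?thesis .
qed

end
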